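(* Let $H,K$ be complex Banach spaces, let $A_0,A_1\in\mathcal L(H,K)$ with $A_0$ singular, and let $A(z)=A_0+A_1z$ for $z\in\mathbb C$. Let $s,r\in\mathbb R$ with $0\le s<r$, let $\mathcal U_{s,r}=\{z\in\mathbb C: s<|z|<r\}$, and let $\{R_j\}_{j\in\mathbb Z}$ be a family of operators in $\mathcal L(K,H)$. Then the formula $R(z)=\sum_{j\in\mathbb Z}R_jz^j$ defines an analytic resolvent $R:\mathcal U_{s,r}\to\mathcal L(K,H)$ for $A$ (that is, the series converges on $\mathcal U_{s,r}$ and $R(z)=A(z)^{-1}$ for all $z\in\mathcal U_{s,r}$) if and only if both of the following hold. (a) (Geometric bounds) For all $\delta,\epsilon>0$ with $s<s+\epsilon<r-\delta<r$ there are constants $c_\delta,d_\epsilon$ such that $\|R_j\|\le c_\delta/(r-\delta)^j$ and $\|R_{-j}\|\le d_\epsilon(s+\epsilon)^j$ for all $j\in\mathbb N$. (b) (Fundamental equations) For every $j\in\mathbb Z$, $$R_{j-1}A_1+R_jA_0=\begin{cases} I & j=0\\ 0& j\ne0\end{cases}\qquad\text{and}\qquad A_1R_{j-1}+A_0R_j=\begin{cases} I & j=0\\ 0& j\ne0,\end{cases}$$ where $I$ is the identity on $H$ in the first system and the identity on $K$ in the second.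
   Context: $\mathcal L(H,K)$ denotes the bounded linear operators from $H$ to $K$, with the operator norm. $\mathbb N=\{1,2,\ldots\}$. "$A_0$ is singular" means that $A_0$ has no inverse in $\mathcal L(K,H)$. A resolvent for $A$ on $\mathcal U_{s,r}$ is a function $R:\mathcal U_{s,r}\to\mathcal L(K,H)$ with $R(z)A(z)=I$ on $H$ and $A(z)R(z)=I$ on $K$ for all $z\in\mathcal U_{s,r}$. *)

theory Defs
  imports "HOL-Analysis.Analysis"
begin

text \<open>
  The distribution has only real normed spaces. A complex normed space is rendered as a real
  one with a scalar multiplication by complex numbers that extends the real one and satisfies
  the vector space axioms and the homogeneity of the norm.
\<close>

class complex_normed_vector = real_normed_vector +
  fixes scaleC :: "complex \<Rightarrow> 'a \<Rightarrow> 'a"  (infixr \<open>*\<^sub>C\<close> 75)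
  assumes scaleC_add_right: "a *\<^sub>C (x + y) = a *\<^sub>C x + a *\<^sub>C y"
    and scaleC_add_left: "(a + b) *\<^sub>C x = a *\<^sub>C x + b *\<^sub>C x"
    and scaleC_scaleC: "a *\<^sub>C b *\<^sub>C x = (a * b) *\<^sub>C x"
    and scaleC_of_real: "complex_of_real r *\<^sub>C x = r *\<^sub>R x"
    and norm_scaleC: "norm (a *\<^sub>C x) = cmod a * norm x"

class complex_banach = complex_normed_vector + banach

lemma bounded_linear_scaleC:
  "bounded_linear (\<lambda>x::'a::complex_normed_vector. c *\<^sub>C x)"
proof
  fix x y :: 'a and r :: real
  show "c *\<^sub>C (x + y) = c *\<^sub>C x + c *\<^sub>C y" by (rule scaleC_add_right)
  show "c *\<^sub>C r *\<^sub>R x = r *\<^sub>R c *\<^sub>C x"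
    by (simp add: scaleC_of_real[symmetric] scaleC_scaleC mult.commute)
  show "\<exists>K. \<forall>x::'a. norm (c *\<^sub>C x) \<le> norm x * K"
    by (rule exI[of _ "cmod c"]) (simp add: norm_scaleC mult.commute)
qed

lemmas scaleC_zero_right [simp] = linear_0[OF bounded_linear.linear[OF bounded_linear_scaleC]]
lemmas scaleC_minus_right = linear_neg[OF bounded_linear.linear[OF bounded_linear_scaleC]]
lemmas scaleC_diff_right = linear_diff[OF bounded_linear.linear[OF bounded_linear_scaleC]]

lemma scaleC_scaleR_commute:
  "a *\<^sub>C r *\<^sub>R (x::'a::complex_normed_vector) = r *\<^sub>R a *\<^sub>C x"
  by (simp add: scaleC_of_real[symmetric] scaleC_scaleC mult.commute)

instantiation complex :: complex_banach
begin

definition scaleC_complex :: "complex \<Rightarrow> complex \<Rightarrow> complex"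
  where "scaleC_complex a x = a * x"

instance
  by standard (simp_all add: scaleC_complex_def algebra_simps norm_mult scaleR_conv_of_real)

end


typedef (overloaded) ('a, 'b) cblinfun (\<open>(_ \<Rightarrow>\<^sub>C\<^sub>L /_)\<close> [22, 21] 21) =
  "{f :: 'a::complex_normed_vector \<Rightarrow> 'b::complex_normed_vector.
      bounded_linear f \<and> (\<forall>c x. f (c *\<^sub>C x) = c *\<^sub>C f x)}"
  morphisms cblinfun_apply CBlinfun
  by (rule exI[of _ "\<lambda>x. 0"]) (simp add: bounded_linear_zero)

setup_lifting type_definition_cblinfun

instantiation cblinfun :: (complex_normed_vector, complex_normed_vector) complex_normed_vector
begin

lift_definition norm_cblinfun :: "('a \<Rightarrow>\<^sub>C\<^sub>L 'b) \<Rightarrow> real" is onorm .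

lift_definition zero_cblinfun :: "'a \<Rightarrow>\<^sub>C\<^sub>L 'b" is "\<lambda>x. 0"
  by (simp add: bounded_linear_zero)

lift_definition plus_cblinfun :: "('a \<Rightarrow>\<^sub>C\<^sub>L 'b) \<Rightarrow> ('a \<Rightarrow>\<^sub>C\<^sub>L 'b) \<Rightarrow> 'a \<Rightarrow>\<^sub>C\<^sub>L 'b"
  is "\<lambda>f g x. f x + g x"
  by (simp add: bounded_linear_add scaleC_add_right)

lift_definition minus_cblinfun :: "('a \<Rightarrow>\<^sub>C\<^sub>L 'b) \<Rightarrow> ('a \<Rightarrow>\<^sub>C\<^sub>L 'b) \<Rightarrow> 'a \<Rightarrow>\<^sub>C\<^sub>L 'b"
  is "\<lambda>f g x. f x - g x"
  by (simp add: bounded_linear_sub scaleC_diff_right)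

lift_definition uminus_cblinfun :: "('a \<Rightarrow>\<^sub>C\<^sub>L 'b) \<Rightarrow> 'a \<Rightarrow>\<^sub>C\<^sub>L 'b" is "\<lambda>f x. - f x"
  by (simp add: bounded_linear_minus scaleC_minus_right)

lift_definition scaleR_cblinfun :: "real \<Rightarrow> ('a \<Rightarrow>\<^sub>C\<^sub>L 'b) \<Rightarrow> 'a \<Rightarrow>\<^sub>C\<^sub>L 'b"
  is "\<lambda>r f x. r *\<^sub>R f x"
  by (simp add: bounded_linear_const_scaleR scaleC_scaleR_commute)

lift_definition scaleC_cblinfun :: "complex \<Rightarrow> ('a \<Rightarrow>\<^sub>C\<^sub>L 'b) \<Rightarrow> 'a \<Rightarrow>\<^sub>C\<^sub>L 'b"
  is "\<lambda>c f x. c *\<^sub>C f x"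
  by (auto simp: scaleC_scaleC mult.commute
      intro: bounded_linear_compose[OF bounded_linear_scaleC])

definition dist_cblinfun :: "('a \<Rightarrow>\<^sub>C\<^sub>L 'b) \<Rightarrow> ('a \<Rightarrow>\<^sub>C\<^sub>L 'b) \<Rightarrow> real"
  where "dist_cblinfun a b = norm (a - b)"

definition [code del]:
  "(uniformity :: (('a \<Rightarrow>\<^sub>C\<^sub>L 'b) \<times> ('a \<Rightarrow>\<^sub>C\<^sub>L 'b)) filter) =
    (INF e\<in>{0 <..}. principal {(x, y). dist x y < e})"

definition open_cblinfun :: "('a \<Rightarrow>\<^sub>C\<^sub>L 'b) set \<Rightarrow> bool"
  where [code del]:
    "open_cblinfun S = (\<forall>x\<in>S. \<forall>\<^sub>F (x', y) in uniformity. x' = x \<longrightarrow> y \<in> S)"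

definition sgn_cblinfun :: "('a \<Rightarrow>\<^sub>C\<^sub>L 'b) \<Rightarrow> 'a \<Rightarrow>\<^sub>C\<^sub>L 'b"
  where "sgn_cblinfun x = scaleR (inverse (norm x)) x"

instance
proof
  fix f :: "'a \<Rightarrow>\<^sub>C\<^sub>L 'b" and c :: complex
  show "norm (c *\<^sub>C f) = cmod c * norm f"
  proof transfer
    fix c :: complex and f :: "'a \<Rightarrow> 'b"
    assume "bounded_linear f \<and> (\<forall>c x. f (c *\<^sub>C x) = c *\<^sub>C f x)"
    then have f: "bounded_linear f" by simp
    have cf: "bounded_linear (\<lambda>x. c *\<^sub>C f x)"
      by (rule bounded_linear_compose[OF bounded_linear_scaleC f])
    have "onorm (\<lambda>x. c *\<^sub>C f x) = onorm (\<lambda>x. cmod c *\<^sub>R f x)"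
      by (simp add: onorm_def norm_scaleC)
    then show "onorm (\<lambda>x. c *\<^sub>C f x) = cmod c * onorm f"
      by (simp add: onorm_scaleR[OF f])
  qed
qed (unfold dist_cblinfun_def open_cblinfun_def sgn_cblinfun_def uniformity_cblinfun_def,
    (rule refl |
      (transfer, force simp: onorm_triangle onorm_scaleR onorm_eq_0 algebra_simps
        scaleC_add_right scaleC_add_left scaleC_scaleC scaleC_of_real))+)

end

instance cblinfun :: (complex_normed_vector, complex_banach) complex_banach
proof
  fix X :: "nat \<Rightarrow> 'a \<Rightarrow>\<^sub>C\<^sub>L 'b"
  assume X: "Cauchy X"
  define e :: "('a \<Rightarrow>\<^sub>C\<^sub>L 'b) \<Rightarrow> 'a \<Rightarrow>\<^sub>L 'b" where "e f = Blinfun (cblinfun_apply f)" for f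
  have app: "blinfun_apply (e f) = cblinfun_apply f" for f
    using cblinfun_apply[of f] by (simp add: e_def bounded_linear_Blinfun_apply)
  have diff: "norm (e f - e g) = norm (f - g)" for f g
    by (simp add: norm_blinfun.rep_eq norm_cblinfun.rep_eq minus_blinfun.rep_eq
        minus_cblinfun.rep_eq app)
  have "Cauchy (\<lambda>n. e (X n))"
    using X by (simp add: Cauchy_def dist_norm diff)
  then obtain L where L: "(\<lambda>n. e (X n)) \<longlonglongrightarrow> L"
    by (auto simp: Cauchy_convergent_iff convergent_def)
  have Lx: "(\<lambda>n. cblinfun_apply (X n) x) \<longlonglongrightarrow> blinfun_apply L x" for x
    using blinfun.tendsto[OF L tendsto_const[of x]] by (simp add: app)
  have "blinfun_apply L (c *\<^sub>C x) = c *\<^sub>C blinfun_apply L x" for c x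
  proof (rule LIMSEQ_unique[OF Lx])
    have "cblinfun_apply (X n) (c *\<^sub>C x) = c *\<^sub>C cblinfun_apply (X n) x" for n
      using cblinfun_apply[of "X n"] by simp
    then show "(\<lambda>n. cblinfun_apply (X n) (c *\<^sub>C x)) \<longlonglongrightarrow> c *\<^sub>C blinfun_apply L x"
      using bounded_linear.tendsto[OF bounded_linear_scaleC Lx] by simp
  qed
  then have "cblinfun_apply (CBlinfun (blinfun_apply L)) = blinfun_apply L"
    by (intro CBlinfun_inverse) (simp add: blinfun.bounded_linear_right)
  then have "e (CBlinfun (blinfun_apply L)) = L"
    by (simp add: e_def blinfun_apply_inverse)
  then have "X \<longlonglongrightarrow> CBlinfun (blinfun_apply L)"
    using L by (simp add: LIMSEQ_def dist_norm flip: diff)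
  then show "convergent X"
    by (rule convergentI)
qed

lift_definition id_cblinfun :: "'a::complex_normed_vector \<Rightarrow>\<^sub>C\<^sub>L 'a" is "\<lambda>x. x"
  by (simp add: bounded_linear_ident)

lift_definition cblinfun_compose ::
  "('b::complex_normed_vector \<Rightarrow>\<^sub>C\<^sub>L 'c::complex_normed_vector) \<Rightarrow>
   ('a::complex_normed_vector \<Rightarrow>\<^sub>C\<^sub>L 'b) \<Rightarrow> 'a \<Rightarrow>\<^sub>C\<^sub>L 'c"  (infixl \<open>o\<^sub>C\<^sub>L\<close> 67)
  is "\<lambda>f g x. f (g x)"
  by (auto intro: bounded_linear_compose)


definition singular ::
  "('a::complex_normed_vector \<Rightarrow>\<^sub>C\<^sub>L 'b::complex_normed_vector) \<Rightarrow> bool"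
  where "singular A \<longleftrightarrow> \<not> (\<exists>B. B o\<^sub>C\<^sub>L A = id_cblinfun \<and> A o\<^sub>C\<^sub>L B = id_cblinfun)"

definition annulus :: "real \<Rightarrow> real \<Rightarrow> complex set"
  where "annulus s r = {z. s < cmod z \<and> cmod z < r}"

definition resolvent_on ::
  "complex set \<Rightarrow> (complex \<Rightarrow> 'a::complex_normed_vector \<Rightarrow>\<^sub>C\<^sub>L 'b::complex_normed_vector) \<Rightarrow>
   (complex \<Rightarrow> 'b \<Rightarrow>\<^sub>C\<^sub>L 'a) \<Rightarrow> bool"
  where "resolvent_on U A R \<longleftrightarrow>
    (\<forall>z\<in>U. R z o\<^sub>C\<^sub>L A z = id_cblinfun \<and> A z o\<^sub>C\<^sub>L R z = id_cblinfun)"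

text \<open>
  Complex differentiability in norm at every point; used below on open sets only. The
  library's \<open>analytic_on\<close> is restricted to complex-valued functions.
\<close>

definition vector_analytic_on ::
  "(complex \<Rightarrow> 'a::complex_normed_vector) \<Rightarrow> complex set \<Rightarrow> bool"
  where "vector_analytic_on f U \<longleftrightarrow>
    (\<forall>z\<in>U. \<exists>D. ((\<lambda>h. inverse h *\<^sub>C (f (z + h) - f z)) \<longlongrightarrow> D) (at 0))"

text \<open>
  Convergence of a doubly infinite series, as is usual for Laurent series: the part with
  nonnegative indices and the part with negative indices converge separately.
\<close>

definition bi_sums :: "(int \<Rightarrow> 'a::real_normed_vector) \<Rightarrow> 'a \<Rightarrow> bool"
  where "bi_sums f S \<longleftrightarrow>
    (\<exists>P N. (\<lambda>n. f (int n)) sums P \<and> (\<lambda>n. f (- int (Suc n))) sums N \<and> S = P + N)"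

end

theory Submission
  imports Defs
begin

text \<open>
  Multiplying \<open>\<Sum> R\<^sub>j z\<^sup>j\<close> by \<open>A\<^sub>0 + A\<^sub>1 z\<close> and shifting the index of one summand gives the Laurent
  series with coefficients \<open>R\<^sub>j\<^sub>-\<^sub>1 A\<^sub>1 + R\<^sub>j A\<^sub>0\<close>; so the resolvent identities are equivalent to the
  fundamental equations as soon as Laurent coefficients are unique. The geometric bounds express
  that the terms of the series are bounded at \<open>r - \<delta>\<close> and at \<open>s + \<epsilon>\<close>, and they make it converge
  absolutely on the annulus. Analyticity does not use the series: the resolvent identity
  \<open>R(z + h) - R(z) = - h R(z + h) A\<^sub>1 R(z)\<close> bounds \<open>R\<close> near \<open>z\<close>, then gives continuity, and then the
  derivative \<open>- R(z) A\<^sub>1 R(z)\<close>.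
\<close>

text \<open>Two notions share this infix. From here on it means that the norms are
  \<open>summable_on\<close> the set, the notion that goes with \<open>has_sum\<close>.\<close>

no_notation Infinite_Set_Sum.abs_summable_on (infix \<open>abs'_summable'_on\<close> 50)

section \<open>Complex scalars and composition of operators\<close>

lemma scaleC_one [simp]: "1 *\<^sub>C (x::'a::complex_normed_vector) = x"
  using scaleC_of_real[of 1 x] by simp

lemma scaleC_zero_left [simp]: "0 *\<^sub>C (x::'a::complex_normed_vector) = 0"
  using scaleC_of_real[of 0 x] by simp

lemma scaleC_minus_left: "(- a) *\<^sub>C (x::'a::complex_normed_vector) = - (a *\<^sub>C x)"
  using scaleC_add_left[of a "- a" x] by (simp add: add_eq_0_iff)

lemma scaleC_sum_left: "sum f A *\<^sub>C (x::'a::complex_normed_vector) = (\<Sum>a\<in>A. f a *\<^sub>C x)"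
  by (induction A rule: infinite_finite_induct) (simp_all add: scaleC_add_left)

lemma bounded_linear_cblinfun_apply: "bounded_linear (cblinfun_apply f)"
  using cblinfun_apply[of f] by simp

lemma norm_cblinfun_compose: "norm (f o\<^sub>C\<^sub>L g) \<le> norm f * norm g"
  using onorm_compose[OF bounded_linear_cblinfun_apply bounded_linear_cblinfun_apply, of f g]
  by (simp add: norm_cblinfun.rep_eq cblinfun_compose.rep_eq o_def)

text \<open>Supplies distributivity and continuity of composition in both arguments. Fixing one
  factor gives the bounded linear maps that are later pulled through Laurent series.\<close>

lemma bounded_bilinear_cblinfun_compose:
  "bounded_bilinear ((o\<^sub>C\<^sub>L) ::
    ('b::complex_normed_vector \<Rightarrow>\<^sub>C\<^sub>L 'c::complex_normed_vector) \<Rightarrow>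
    ('a::complex_normed_vector \<Rightarrow>\<^sub>C\<^sub>L 'b) \<Rightarrow> 'a \<Rightarrow>\<^sub>C\<^sub>L 'c)"
  (is "bounded_bilinear ?comp")
proof
  show "\<exists>K. \<forall>f g. norm (?comp f g) \<le> norm f * norm g * K"
    by (rule exI[of _ 1]) (simp add: norm_cblinfun_compose)
qed (transfer; auto simp: fun_eq_iff bounded_linear.linear linear_add linear_cmul)+

interpretation cblinfun_compose: bounded_bilinear
  "(o\<^sub>C\<^sub>L) :: ('b::complex_normed_vector \<Rightarrow>\<^sub>C\<^sub>L 'c::complex_normed_vector) \<Rightarrow>
     ('a::complex_normed_vector \<Rightarrow>\<^sub>C\<^sub>L 'b) \<Rightarrow> 'a \<Rightarrow>\<^sub>C\<^sub>L 'c"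
  by (rule bounded_bilinear_cblinfun_compose)

lemma cblinfun_compose_scaleC_left: "(c *\<^sub>C f) o\<^sub>C\<^sub>L g = c *\<^sub>C (f o\<^sub>C\<^sub>L g)"
  by transfer simp

lemma cblinfun_compose_scaleC_right: "f o\<^sub>C\<^sub>L (c *\<^sub>C g) = c *\<^sub>C (f o\<^sub>C\<^sub>L g)"
  by transfer auto

lemma cblinfun_compose_assoc: "(f o\<^sub>C\<^sub>L g) o\<^sub>C\<^sub>L h = f o\<^sub>C\<^sub>L (g o\<^sub>C\<^sub>L h)"
  by transfer simp

lemma cblinfun_compose_id_left [simp]: "id_cblinfun o\<^sub>C\<^sub>L f = f"
  by transfer simp

lemma cblinfun_compose_id_right [simp]: "f o\<^sub>C\<^sub>L id_cblinfun = f"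
  by transfer simp


subsection \<open>Doubly infinite series\<close>

text \<open>The two pieces are the index sets of the two series in \<open>bi_sums\<close>, so
  unordered sums over the integers are cut along this partition.\<close>

lemma UNIV_int_split: "(UNIV :: int set) = range int \<union> range (\<lambda>n. - int (Suc n))"
proof -
  have "j \<in> range int \<union> range (\<lambda>n. - int (Suc n))" for j :: int
    by (cases j) auto
  then show ?thesis by blast
qed

lemma range_int_disjoint: "range int \<inter> range (\<lambda>n. - int (Suc n)) = {}"
  by auto

lemma inj_minus_int_Suc: "inj (\<lambda>n. - int (Suc n))"
  by (auto simp: inj_def)

lemma bi_sums_unique:
  assumes "bi_sums f S" "bi_sums f T"
  shows "S = T"
  using assms unfolding bi_sums_def by (auto dest: sums_unique2)

lemma abs_summable_on_int:
  fixes f :: "int \<Rightarrow> 'a::real_normed_vector"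
  assumes "summable (\<lambda>n. norm (f (int n)))" "summable (\<lambda>n. norm (f (- int (Suc n))))"
  shows "f abs_summable_on UNIV"
  unfolding UNIV_int_split
proof (rule summable_on_Un_disjoint[OF _ _ range_int_disjoint])
  show "f abs_summable_on range int"
    using norm_summable_imp_summable_on[of "\<lambda>n. norm (f (int n))"] assms(1)
    by (simp add: summable_on_reindex o_def)
  show "f abs_summable_on range (\<lambda>n. - int (Suc n))"
    using norm_summable_imp_summable_on[of "\<lambda>n. norm (f (- int (Suc n)))"] assms(2)
    by (subst summable_on_reindex[OF inj_minus_int_Suc]) (simp add: o_def)
qed

text \<open>In a Banach space absolute summability passes to summability on each half; the two
  partial sums then add up to the whole, and reindexing turns each into an ordinary series.\<close>

lemma has_sum_imp_bi_sums:
  fixes f :: "int \<Rightarrow> 'a::banach"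
  assumes "f abs_summable_on UNIV" "(f has_sum S) UNIV"
  shows "bi_sums f S"
proof -
  have *: "f summable_on A" for A
    using assms(1) by (rule abs_summable_summable[OF summable_on_subset_banach]) auto
  obtain P where P: "(f has_sum P) (range int)"
    using *[of "range int"] by (auto simp: summable_on_def)
  obtain N where N: "(f has_sum N) (range (\<lambda>n. - int (Suc n)))"
    using *[of "range (\<lambda>n. - int (Suc n))"] by (auto simp: summable_on_def)
  have "(f has_sum (P + N)) UNIV"
    unfolding UNIV_int_split by (rule has_sum_Un_disjoint[OF P N range_int_disjoint])
  then have "S = P + N"
    using assms(2) has_sum_unique by blast
  moreover have "(\<lambda>n. f (int n)) sums P"
    using P by (intro has_sum_imp_sums) (simp add: has_sum_reindex o_def)
  moreover have "(\<lambda>n. f (- int (Suc n))) sums N"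
    using N unfolding has_sum_reindex[OF inj_minus_int_Suc] o_def by (rule has_sum_imp_sums)
  ultimately show ?thesis
    unfolding bi_sums_def by blast
qed

text \<open>The unordered sum exists by absolute summability and is also a \<open>bi_sums\<close>
  value, hence the given one. Unordered sums are preferred because they permit shifting the
  index.\<close>

lemma bi_sums_imp_has_sum:
  fixes f :: "int \<Rightarrow> 'a::banach"
  assumes "f abs_summable_on UNIV" "bi_sums f S"
  shows "(f has_sum S) UNIV"
proof -
  have "(f has_sum infsum f UNIV) UNIV"
    by (rule has_sum_infsum[OF abs_summable_summable[OF assms(1)]])
  with has_sum_imp_bi_sums[OF assms(1)] bi_sums_unique assms(2) show ?thesis
    by metis
qed

text \<open>The terms of each convergent half tend to zero. This is the source of the geometric
  bounds.\<close>

lemma bi_sums_bounded: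
  assumes "bi_sums f S"
  obtains C D where "\<And>n. norm (f (int n)) \<le> C" "\<And>n. norm (f (- int (Suc n))) \<le> D"
proof -
  have "summable (\<lambda>n. f (int n))" "summable (\<lambda>n. f (- int (Suc n)))"
    using assms by (auto simp: bi_sums_def sums_iff)
  then have "Bseq (\<lambda>n. f (int n))" "Bseq (\<lambda>n. f (- int (Suc n)))"
    by (auto intro: convergent_imp_Bseq convergentI summable_LIMSEQ_zero)
  then show ?thesis
    using that unfolding Bseq_def by blast
qed

lemma has_sum_diff_vector:
  fixes f g :: "'a \<Rightarrow> 'b::real_normed_vector"
  assumes "(f has_sum S) A" "(g has_sum T) A"
  shows "((\<lambda>x. f x - g x) has_sum (S - T)) A"
  using has_sum_add[OF assms(1), of "\<lambda>x. - g x" "- T"] assms(2) by (simp add: has_sum_uminus)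

lemma has_sum_sum_vector:
  fixes f :: "'i \<Rightarrow> 'a \<Rightarrow> 'b::real_normed_vector"
  assumes "\<And>i. (f i has_sum S i) A"
  shows "((\<lambda>x. \<Sum>i\<in>I. f i x) has_sum (\<Sum>i\<in>I. S i)) A"
  by (induction I rule: infinite_finite_induct) (auto intro: has_sum_add assms)

lemma bij_minus_one_int: "bij (\<lambda>j::int. j - 1)"
  by (rule bij_betw_byWitness[of _ "\<lambda>j. j + 1"]) auto


subsection \<open>Laurent series with vector coefficients\<close>

lemma norm_powi_scaleC:
  "norm ((z powi j) *\<^sub>C (x::'a::complex_normed_vector)) = cmod z powi j * norm x"
  by (simp add: norm_scaleC norm_power_int)

text \<open>Both halves are dominated by geometric series, with ratios \<open>cmod z / a\<close> and
  \<open>b / cmod z\<close>, each less than 1.\<close>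

lemma geometric_bounds_imp_abs_summable:
  fixes R :: "int \<Rightarrow> 'a::complex_normed_vector"
  assumes b: "0 < b" "b < cmod z" and a: "cmod z < a"
    and R: "\<And>j::nat. j \<ge> 1 \<Longrightarrow> norm (R (int j)) \<le> c / a ^ j \<and> norm (R (- int j)) \<le> d * b ^ j"
  shows "(\<lambda>j. (z powi j) *\<^sub>C R j) abs_summable_on UNIV"
proof (rule abs_summable_on_int)
  have z: "cmod z > 0" "a > 0" using a b by auto
  have "summable (\<lambda>n. c * (cmod z / a) ^ n)"
    using a z by (intro summable_mult summable_geometric) auto
  then show "summable (\<lambda>n. norm ((z powi int n) *\<^sub>C R (int n)))"
  \<comment> \<open>The comparison starts at 1 because the bounds say nothing about
    \<open>R 0\<close>.\<close>
  proof (rule summable_comparison_test'[of _ 1])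
    fix n :: nat assume "n \<ge> 1"
    then have "cmod z ^ n * norm (R (int n)) \<le> cmod z ^ n * (c / a ^ n)"
      using R by (intro mult_left_mono) auto
    then show "norm (norm ((z powi int n) *\<^sub>C R (int n))) \<le> c * (cmod z / a) ^ n"
      by (simp add: norm_scaleC norm_power power_divide mult.commute)
  qed
  have "summable (\<lambda>n. d * (b / cmod z) ^ Suc n)"
    unfolding summable_Suc_iff using b z
    by (intro summable_mult summable_Suc_iff[THEN iffD2] summable_geometric) auto
  then show "summable (\<lambda>n. norm ((z powi - int (Suc n)) *\<^sub>C R (- int (Suc n))))"
  proof (rule summable_comparison_test'[of _ 0])
    fix n :: nat
    have "norm (R (- int (Suc n))) / cmod z ^ Suc n \<le> (d * b ^ Suc n) / cmod z ^ Suc n"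
      using R[of "Suc n"] z by (intro divide_right_mono) auto
    moreover have "cmod z powi - int (Suc n) = inverse (cmod z ^ Suc n)"
      by (metis power_int_minus power_int_of_nat)
    ultimately show "norm (norm ((z powi - int (Suc n)) *\<^sub>C R (- int (Suc n)))) \<le> d * (b / cmod z) ^ Suc n"
      by (simp only: norm_powi_scaleC power_divide real_norm_def abs_mult abs_norm_cancel) (simp add: field_simps)
  qed
qed

text \<open>Stated for abstract maps \<open>L0\<close> and \<open>L1\<close> so that composition
  with the pencil from the left and from the right are two instances of one argument.\<close>

lemma laurent_linear_factor:
  fixes R :: "int \<Rightarrow> 'a::complex_banach" and L0 L1 :: "'a \<Rightarrow> 'b::complex_banach"
  assumes L0: "bounded_linear L0" "\<And>c x. L0 (c *\<^sub>C x) = c *\<^sub>C L0 x"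
    and L1: "bounded_linear L1" "\<And>c x. L1 (c *\<^sub>C x) = c *\<^sub>C L1 x"
    and "z \<noteq> 0" and abs: "(\<lambda>j. (z powi j) *\<^sub>C R j) abs_summable_on UNIV"
  shows "(\<lambda>j. (z powi j) *\<^sub>C (L1 (R (j - 1)) + L0 (R j))) abs_summable_on UNIV" (is "?f abs_summable_on _")
    and "((\<lambda>j. (z powi j) *\<^sub>C R j) has_sum S) UNIV \<Longrightarrow>
      ((\<lambda>j. (z powi j) *\<^sub>C (L1 (R (j - 1)) + L0 (R j))) has_sum (L0 S + z *\<^sub>C L1 S)) UNIV"
proof -
  let ?g = "\<lambda>j. (z powi j) *\<^sub>C R j"
  have zL1: "bounded_linear (\<lambda>x. z *\<^sub>C L1 x)"
    by (rule bounded_linear_compose[OF bounded_linear_scaleC L1(1)])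
  \<comment> \<open>One factor \<open>z\<close> is split off \<open>z powi j\<close> to match the
    index \<open>j - 1\<close>. This needs \<open>z \<noteq> 0\<close>: at zero the identity fails
    for \<open>j = 0\<close>.\<close>
  have eq: "?f j = L0 (?g j) + z *\<^sub>C L1 (?g (j - 1))" for j
  proof -
    have "z powi j = z * z powi (j - 1)"
      using power_int_minus_mult[of z j] \<open>z \<noteq> 0\<close> by (simp add: mult.commute)
    then show ?thesis
      by (simp add: L0 L1 scaleC_add_right scaleC_scaleC)
  qed
  have abs': "(\<lambda>j. ?g (j - 1)) abs_summable_on UNIV"
    using summable_on_reindex_bij_betw[OF bij_minus_one_int, of "\<lambda>j. norm (?g j)"] abs by simp
  obtain K0 where K0: "\<And>x. norm (L0 x) \<le> norm x * K0"
    using bounded_linear.bounded[OF L0(1)] by blast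
  obtain K1 where K1: "\<And>x. norm (z *\<^sub>C L1 x) \<le> norm x * K1"
    using bounded_linear.bounded[OF zL1] by blast
  have "(\<lambda>j. norm (?g j) * K0 + norm (?g (j - 1)) * K1) summable_on UNIV"
    by (intro summable_on_add summable_on_cmult_left abs abs')
  then show "?f abs_summable_on UNIV"
  proof (rule summable_on_comparison_test)
    fix j :: int
    show "norm (?f j) \<le> norm (?g j) * K0 + norm (?g (j - 1)) * K1"
      unfolding eq by (rule order.trans[OF norm_triangle_ineq add_mono[OF K0 K1]])
  qed simp
  assume S: "(?g has_sum S) UNIV"
  have "((\<lambda>j. ?g (j - 1)) has_sum S) UNIV"
    using has_sum_reindex_bij_betw[OF bij_minus_one_int, of ?g S] S by simp
  then show "(?f has_sum (L0 S + z *\<^sub>C L1 S)) UNIV"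
    unfolding eq
    by (intro has_sum_add has_sum_bounded_linear[OF L0(1) S] has_sum_bounded_linear[OF zL1])
qed

section \<open>Uniqueness of Laurent coefficients\<close>

text \<open>A geometric sum over the powers of an \<open>n\<close>-th root of unity
  \<open>w\<close>. It vanishes unless \<open>w = 1\<close>, which would make \<open>n\<close>
  divide \<open>j\<close>, impossible for \<open>0 < \<bar>j\<bar> < n\<close>.\<close>

lemma sum_cis_multiples:
  fixes n :: nat and j :: int
  assumes "\<bar>j\<bar> < int n" "j \<noteq> 0"
  shows "(\<Sum>m<n. cis (2 * pi * of_int j * of_nat m / of_nat n)) = 0"
proof -
  define w where "w = cis (2 * pi * of_int j / of_nat n)"
  have n: "n > 0" using assms by linarith
  have "w ^ n = cis (2 * pi * of_int j)"
  proof -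
    have "real n * (2 * pi * of_int j / of_nat n) = 2 * pi * of_int j"
      using n by simp
    then show ?thesis
      unfolding w_def Complex.DeMoivre by (rule arg_cong)
  qed
  then have wn: "w ^ n = 1"
    by (simp add: cis_multiple_2pi)
  have "w \<noteq> 1"
  proof
    assume "w = 1"
    then have "cos (2 * pi * of_int j / of_nat n) = 1"
      by (simp add: w_def complex_eq_iff)
    then obtain k :: int where "2 * pi * of_int j / of_nat n = of_int k * 2 * pi"
      by (auto simp: cos_one_2pi_int)
    then have "2 * pi * of_int j = 2 * pi * (of_int k * of_nat n)"
      using n by (simp add: field_simps)
    then have "real_of_int j = of_int k * of_nat n"
      by (metis mult_cancel_left mult_eq_0_iff pi_neq_zero zero_neq_numeral)
    then have "real_of_int j = real_of_int (k * int n)" by simp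
    then have "j = k * int n" by linarith
    then have "int n dvd j" by simp
    then show False
      using assms zdvd_not_zless[of "\<bar>j\<bar>" "int n"] by auto
  qed
  have "(\<Sum>m<n. cis (2 * pi * of_int j * of_nat m / of_nat n)) = (\<Sum>m<n. w ^ m)"
    unfolding w_def Complex.DeMoivre
    by (rule sum.cong[OF refl], rule arg_cong[where f = cis]) simp
  also have "\<dots> = 0"
    using \<open>w \<noteq> 1\<close> wn by (simp add: geometric_sum)
  finally show ?thesis .
qed

text \<open>
  Averaging over the rotations by \<^term>\<open>n\<close>-th roots of unity kills every coefficient whose
  index differs from \<^term>\<open>k\<close> by less than \<^term>\<open>n\<close>, except the one with index \<^term>\<open>k\<close>.
\<close>

lemma laurent_zero_imp_coeff_zero:
  fixes c :: "int \<Rightarrow> 'a::complex_normed_vector"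
  assumes "\<rho> > 0" and abs: "(\<lambda>j. (complex_of_real \<rho> powi j) *\<^sub>C c j) abs_summable_on UNIV"
    and zero: "\<And>z. cmod z = \<rho> \<Longrightarrow> ((\<lambda>j. (z powi j) *\<^sub>C c j) has_sum 0) UNIV"
  shows "c k = 0"
proof -
  define a where "a j = (complex_of_real \<rho> powi j) *\<^sub>C c j" for j
  have norm_a: "norm (a k) \<le> e" if "e > 0" for e
  proof -
    have sm: "(\<lambda>j. norm (a j)) summable_on A" for A
      unfolding a_def by (rule summable_on_subset_banach[OF abs]) simp
    \<comment> \<open>\<open>F\<close> carries the total of the norms up to \<open>e\<close>.
      Adjoining \<open>k\<close> can only shrink the tail, so the tail outside \<open>G\<close> is
      at most \<open>e\<close>.\<close>
    obtain F where F: "finite F" "dist (\<Sum>j\<in>F. norm (a j)) (infsum (\<lambda>j. norm (a j)) UNIV) \<le> e"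
      using has_sum_finite_approximation[OF has_sum_infsum[OF sm[of UNIV]] \<open>e > 0\<close>] by blast
    define G where "G = insert k F"
    have G: "finite G" "k \<in> G" "F \<subseteq> G" using F by (auto simp: G_def)
    have split: "infsum (\<lambda>j. norm (a j)) UNIV = (\<Sum>j\<in>A. norm (a j)) + infsum (\<lambda>j. norm (a j)) (- A)"
      if "finite A" for A
      using infsum_Un_disjoint[OF sm[of A] sm[of "- A"]] that by (simp add: Un_commute)
    have "(\<Sum>j\<in>F. norm (a j)) \<le> (\<Sum>j\<in>G. norm (a j))"
      using G by (intro sum_mono2) auto
    then have tail: "infsum (\<lambda>j. norm (a j)) (- G) \<le> e"
      using split[OF F(1)] split[OF G(1)] F(2) infsum_nonneg[of "- F" "\<lambda>j. norm (a j)"]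
      by (auto simp: dist_real_def)
    \<comment> \<open>Taking \<open>n\<close> larger than every distance from \<open>k\<close> to an
      index in \<open>G\<close> lets the averaging kill all of \<open>G\<close> except
      \<open>k\<close>.\<close>
    obtain n :: nat where n: "n > 0" "\<And>j. j \<in> G \<Longrightarrow> \<bar>j - k\<bar> < int n"
    proof
      show "nat (Max ((\<lambda>j. \<bar>j - k\<bar>) ` G)) + 1 > 0" by simp
      fix j assume "j \<in> G"
      then have "\<bar>j - k\<bar> \<le> Max ((\<lambda>j. \<bar>j - k\<bar>) ` G)"
        using G by (intro Max_ge) auto
      then show "\<bar>j - k\<bar> < int (nat (Max ((\<lambda>j. \<bar>j - k\<bar>) ` G)) + 1)" by linarith
    qed
    \<comment> \<open>The weight of index \<open>j\<close> after rotating by the angle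
      \<open>2 * pi * m / n\<close> and multiplying by the constant that restores weight 1 at index
      \<open>k\<close>; \<open>v\<close> is the average over \<open>m\<close>.\<close>
    define w where "w j m = cis (2 * pi * of_int (j - k) * of_nat m / of_nat n)" for j m
    define v where "v j = (\<Sum>m<n. w j m) / of_nat n" for j
    have rot: "((\<lambda>j. w j m *\<^sub>C a j) has_sum 0) UNIV" for m
    proof -
      define t where "t = 2 * pi * of_nat m / of_nat n"
      have w: "w j m = cis (- of_int k * t) * cis t powi j" for j
        by (simp add: w_def t_def cis_power_int cis_mult algebra_simps diff_divide_distrib)
      have "((\<lambda>j. ((\<rho> * cis t) powi j) *\<^sub>C c j) has_sum 0) UNIV"
        by (rule zero) (use \<open>\<rho> > 0\<close> in \<open>simp add: norm_mult\<close>)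
      from has_sum_bounded_linear[OF bounded_linear_scaleC[of "cis (- of_int k * t)"] this]
      show ?thesis
        unfolding w by (simp add: a_def scaleC_scaleC power_int_mult_distrib mult_ac)
    qed
    have "((\<lambda>j. \<Sum>m<n. w j m *\<^sub>C a j) has_sum (\<Sum>m<n. 0)) UNIV"
      by (rule has_sum_sum_vector[OF rot])
    from has_sum_bounded_linear[OF bounded_linear_scaleC[of "1 / of_nat n"] this]
    have v_sum: "((\<lambda>j. v j *\<^sub>C a j) has_sum 0) UNIV"
      by (simp add: v_def scaleC_scaleC flip: scaleC_sum_left)
    have vk: "v k = 1" using n by (simp add: v_def w_def)
    have v0: "v j = 0" if "j \<in> G" "j \<noteq> k" for j
      using sum_cis_multiples[of "j - k" n] n(2)[OF that(1)] that(2) by (simp add: v_def w_def)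
    have v1: "cmod (v j) \<le> 1" for j
    proof -
      have "cmod (\<Sum>m<n. w j m) \<le> (\<Sum>m<n. 1)"
        by (rule sum_norm_le) (simp add: w_def)
      then show ?thesis using n(1) by (simp add: v_def norm_divide)
    qed
    have "((\<lambda>j. if j = k then a k else 0) has_sum a k) {k}"
      by (rule has_sum_finiteI) auto
    then have "((\<lambda>j. if j = k then a k else 0) has_sum a k) UNIV"
      by (subst has_sum_cong_neutral[where T = "{k}" and g = "\<lambda>j. if j = k then a k else 0"]) auto
    from has_sum_diff_vector[OF v_sum this]
    have "((\<lambda>j. v j *\<^sub>C a j - (if j = k then a k else 0)) has_sum (- a k)) UNIV"
      by simp
    \<comment> \<open>On \<open>G\<close> every term vanishes: \<open>v j = 0\<close> for
      \<open>j \<noteq> k\<close>, and the term at \<open>k\<close> has been subtracted. So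
      \<open>- a k\<close> is a sum over the tail alone, with weights of modulus at most 1.\<close>
    then have rest: "((\<lambda>j. v j *\<^sub>C a j) has_sum (- a k)) (- G)"
      by (rule has_sum_cong_neutral[THEN iffD1, rotated 3]) (use G vk v0 in auto)
    have le: "norm (v j *\<^sub>C a j) \<le> norm (a j)" for j
      using v1[of j] by (simp add: norm_scaleC mult_left_le_one_le)
    have sv: "(\<lambda>j. v j *\<^sub>C a j) abs_summable_on - G"
      by (rule summable_on_comparison_test[OF sm]) (auto simp: le)
    have "norm (- a k) \<le> infsum (\<lambda>j. norm (v j *\<^sub>C a j)) (- G)"
      by (rule norm_has_sum_bound[OF has_sum_infsum[OF sv] rest])
    also have "\<dots> \<le> infsum (\<lambda>j. norm (a j)) (- G)"
      by (rule infsum_mono[OF sv sm le])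
    finally show ?thesis using tail by simp
  qed
  have "norm (a k) \<le> 0"
    by (rule field_le_epsilon) (use norm_a in simp)
  then have "norm (complex_of_real \<rho> powi k) * norm (c k) = 0"
    by (simp add: a_def flip: norm_scaleC)
  then show ?thesis using \<open>\<rho> > 0\<close> by simp
qed

lemma has_sum_constant_laurent:
  fixes E :: "'a::complex_normed_vector"
  shows "((\<lambda>j. (z powi j) *\<^sub>C (if j = 0 then E else 0)) has_sum E) UNIV"
proof -
  have "((\<lambda>j::int. if j = 0 then E else 0) has_sum E) {0}"
    by (rule has_sum_finiteI) auto
  then show ?thesis
    by (subst has_sum_cong_neutral[where T = "{0}" and g = "\<lambda>j. if j = 0 then E else 0"]) auto
qed

text \<open>Subtracting the one-term series with coefficient \<open>E\<close> at index 0 reduces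
  this to a series with sum zero on the circle.\<close>

lemma laurent_constant_imp_coeff:
  fixes c :: "int \<Rightarrow> 'a::complex_normed_vector"
  assumes "\<rho> > 0" and abs: "(\<lambda>j. (complex_of_real \<rho> powi j) *\<^sub>C c j) abs_summable_on UNIV"
    and const: "\<And>z. cmod z = \<rho> \<Longrightarrow> ((\<lambda>j. (z powi j) *\<^sub>C c j) has_sum E) UNIV"
  shows "c k = (if k = 0 then E else 0)"
proof -
  let ?E = "\<lambda>j::int. if j = 0 then E else 0"
  have "(\<lambda>j. (complex_of_real \<rho> powi j) *\<^sub>C (c j - ?E j)) abs_summable_on UNIV"
  proof (rule summable_on_comparison_test)
    have "(\<lambda>j. norm ((complex_of_real \<rho> powi j) *\<^sub>C ?E j)) summable_on UNIV"
      by (rule finite_nonzero_values_imp_summable_on, rule finite_subset[of _ "{0}"]) auto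
    then show "(\<lambda>j. norm ((complex_of_real \<rho> powi j) *\<^sub>C c j) + norm ((complex_of_real \<rho> powi j) *\<^sub>C ?E j)) summable_on UNIV"
      by (intro summable_on_add abs)
  qed (simp_all only: scaleC_diff_right norm_triangle_ineq4 norm_ge_zero)
  moreover have "((\<lambda>j. (z powi j) *\<^sub>C (c j - ?E j)) has_sum 0) UNIV" if "cmod z = \<rho>" for z
    using has_sum_diff_vector[OF const[OF that] has_sum_constant_laurent[of z E]]
    by (simp only: scaleC_diff_right diff_self)
  ultimately have "c k - ?E k = 0"
    by (rule laurent_zero_imp_coeff_zero[OF \<open>\<rho> > 0\<close>, where c = "\<lambda>j. c j - ?E j"])
  then show ?thesis by simp
qed


subsection \<open>Resolvents of a linear pencil\<close>

text \<open>\<open>Q\<close> is a left inverse at \<open>y\<close> and \<open>P\<close> a right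
  inverse at \<open>z\<close>; inserting both identities leaves the difference of the two pencil
  values, \<open>(z - y) *\<^sub>C A\<^sub>1\<close>, between \<open>Q\<close> and
  \<open>P\<close>.\<close>

lemma resolvent_equation:
  assumes "Q o\<^sub>C\<^sub>L (A\<^sub>0 + y *\<^sub>C A\<^sub>1) = id_cblinfun" "(A\<^sub>0 + z *\<^sub>C A\<^sub>1) o\<^sub>C\<^sub>L P = id_cblinfun"
  shows "Q - P = (z - y) *\<^sub>C (Q o\<^sub>C\<^sub>L A\<^sub>1 o\<^sub>C\<^sub>L P)"
proof -
  have "Q - P = Q o\<^sub>C\<^sub>L ((A\<^sub>0 + z *\<^sub>C A\<^sub>1) o\<^sub>C\<^sub>L P) - (Q o\<^sub>C\<^sub>L (A\<^sub>0 + y *\<^sub>C A\<^sub>1)) o\<^sub>C\<^sub>L P"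
    by (simp add: assms)
  also have "\<dots> = Q o\<^sub>C\<^sub>L ((z - y) *\<^sub>C A\<^sub>1) o\<^sub>C\<^sub>L P"
  proof -
    have "(z - y) *\<^sub>C A\<^sub>1 = (A\<^sub>0 + z *\<^sub>C A\<^sub>1) - (A\<^sub>0 + y *\<^sub>C A\<^sub>1)"
      using scaleC_add_left[of "z - y" y A\<^sub>1] by simp
    then show ?thesis
      by (simp only: cblinfun_compose_assoc cblinfun_compose.diff_left cblinfun_compose.diff_right)
  qed
  finally show ?thesis
    by (simp add: cblinfun_compose_scaleC_left cblinfun_compose_scaleC_right)
qed

lemma open_annulus: "open (annulus s r)"
  unfolding annulus_def by (intro open_Collect_conj open_Collect_less continuous_intros)

lemma resolvent_vector_analytic:
  assumes "open U" and res: "resolvent_on U (\<lambda>z. A\<^sub>0 + z *\<^sub>C A\<^sub>1) Rf"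
  shows "vector_analytic_on Rf U"
  unfolding vector_analytic_on_def
proof
  fix z assume z: "z \<in> U"
  define K where "K = norm A\<^sub>1 * norm (Rf z)"
  have ev: "\<forall>\<^sub>F h in at 0. z + h \<in> U"
  proof -
    have "((\<lambda>h. z + h) \<longlongrightarrow> z + 0) (at 0)" by (intro tendsto_intros)
    from topological_tendstoD[OF this \<open>open U\<close>] z show ?thesis by simp
  qed
  have eq: "Rf (z + h) - Rf z = (- h) *\<^sub>C (Rf (z + h) o\<^sub>C\<^sub>L A\<^sub>1 o\<^sub>C\<^sub>L Rf z)" if "z + h \<in> U" for h
    using resolvent_equation[of "Rf (z + h)" A\<^sub>0 "z + h" A\<^sub>1 z "Rf z"] res z that
    by (simp add: resolvent_on_def)
  have diff_le: "norm (Rf (z + h) - Rf z) \<le> cmod h * (K * norm (Rf (z + h)))" if "z + h \<in> U" for h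
  proof -
    have "norm (Rf (z + h) o\<^sub>C\<^sub>L A\<^sub>1 o\<^sub>C\<^sub>L Rf z) \<le> norm (Rf (z + h)) * norm A\<^sub>1 * norm (Rf z)"
      by (rule order.trans[OF norm_cblinfun_compose mult_right_mono[OF norm_cblinfun_compose norm_ge_zero]])
    from mult_left_mono[OF this norm_ge_zero[of h]] show ?thesis
      by (simp add: eq[OF that] norm_scaleC K_def mult_ac)
  qed
  \<comment> \<open>Below 1/2, \<open>diff_le\<close> bounds the increment by half of
    \<open>norm (Rf (z + h))\<close>. Absorbing that half gives
    \<open>norm (Rf (z + h)) \<le> 2 * norm (Rf z)\<close>, a bound free of
    \<open>h\<close>.\<close>
  have small: "\<forall>\<^sub>F h in at 0. cmod h * K < 1 / 2"
  proof -
    have "((\<lambda>h. cmod h * K) \<longlongrightarrow> cmod 0 * K) (at 0)" by (intro tendsto_intros)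
    then show ?thesis by (rule order_tendstoD) simp
  qed
  have bound: "\<forall>\<^sub>F h in at 0. norm (Rf (z + h) - Rf z) \<le> cmod h * (K * (2 * norm (Rf z)))"
    using ev small
  proof eventually_elim
    case (elim h)
    have "cmod h * K * norm (Rf (z + h)) \<le> 1 / 2 * norm (Rf (z + h))"
      using elim by (intro mult_right_mono) auto
    then have "norm (Rf (z + h)) \<le> 2 * norm (Rf z)"
      using diff_le[OF elim(1)] norm_triangle_ineq2[of "Rf (z + h)" "Rf z"] by (simp add: mult.assoc)
    then have "cmod h * (K * norm (Rf (z + h))) \<le> cmod h * (K * (2 * norm (Rf z)))"
      by (intro mult_left_mono) (auto simp: K_def)
    with diff_le[OF elim(1)] show ?case by linarith
  qed
  have "((\<lambda>h. Rf (z + h) - Rf z) \<longlongrightarrow> 0) (at 0)"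
  proof (rule Lim_null_comparison[OF bound])
    have "((\<lambda>h. cmod h * (K * (2 * norm (Rf z)))) \<longlongrightarrow> cmod 0 * (K * (2 * norm (Rf z)))) (at 0)"
      by (intro tendsto_intros)
    then show "((\<lambda>h. cmod h * (K * (2 * norm (Rf z)))) \<longlongrightarrow> 0) (at 0)" by simp
  qed
  then have cont: "((\<lambda>h. Rf (z + h)) \<longlongrightarrow> Rf z) (at 0)"
    by (rule LIM_zero_cancel)
  have "((\<lambda>h. - (Rf (z + h) o\<^sub>C\<^sub>L A\<^sub>1 o\<^sub>C\<^sub>L Rf z)) \<longlongrightarrow> - (Rf z o\<^sub>C\<^sub>L A\<^sub>1 o\<^sub>C\<^sub>L Rf z)) (at 0)"
    by (intro tendsto_minus cblinfun_compose.tendsto cont tendsto_const)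
  \<comment> \<open>For \<open>h \<noteq> 0\<close> the factor \<open>- h\<close> in
    \<open>eq\<close> cancels, so the difference quotient equals this product exactly and inherits
    its limit.\<close>
  moreover have "\<forall>\<^sub>F h in at 0. - (Rf (z + h) o\<^sub>C\<^sub>L A\<^sub>1 o\<^sub>C\<^sub>L Rf z) = inverse h *\<^sub>C (Rf (z + h) - Rf z)"
    using ev eventually_neq_at_within[of 0]
  proof eventually_elim
    case (elim h)
    then show ?case by (simp add: eq scaleC_scaleC scaleC_minus_left scaleC_minus_right)
  qed
  ultimately have "((\<lambda>h. inverse h *\<^sub>C (Rf (z + h) - Rf z)) \<longlongrightarrow> - (Rf z o\<^sub>C\<^sub>L A\<^sub>1 o\<^sub>C\<^sub>L Rf z)) (at 0)"
    by (rule Lim_transform_eventually)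
  then show "\<exists>D. ((\<lambda>h. inverse h *\<^sub>C (Rf (z + h) - Rf z)) \<longlongrightarrow> D) (at 0)"
    by (rule exI)
qed

text \<open>Bounded terms at the real point \<open>a\<close> limit the coefficients of positive
  index, those at \<open>b\<close> the coefficients of negative index. Applied with
  \<open>a = r - \<delta>\<close> and \<open>b = s + \<epsilon>\<close>.\<close>

lemma annulus_laurent_bounds:
  fixes R :: "int \<Rightarrow> 'a::complex_normed_vector"
  assumes conv: "\<And>z. z \<in> annulus s r \<Longrightarrow> \<exists>S. bi_sums (\<lambda>j. (z powi j) *\<^sub>C R j) S"
    and ab: "0 < b" "s < b" "b < r" "0 < a" "s < a" "a < r"
  shows "\<exists>c d. \<forall>j::nat. j \<ge> 1 \<longrightarrow> norm (R (int j)) \<le> c / a ^ j \<and> norm (R (- int j)) \<le> d * b ^ j"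
proof -
  have mem: "complex_of_real a \<in> annulus s r" "complex_of_real b \<in> annulus s r"
    using ab by (auto simp: annulus_def)
  obtain S1 S2 where S1: "bi_sums (\<lambda>j. (complex_of_real a powi j) *\<^sub>C R j) S1"
    and S2: "bi_sums (\<lambda>j. (complex_of_real b powi j) *\<^sub>C R j) S2"
    using conv mem by blast
  obtain c where c: "\<And>n. norm ((complex_of_real a powi int n) *\<^sub>C R (int n)) \<le> c"
    by (rule bi_sums_bounded[OF S1]) (rule that)
  obtain d where d: "\<And>n. norm ((complex_of_real b powi - int (Suc n)) *\<^sub>C R (- int (Suc n))) \<le> d"
    by (rule bi_sums_bounded[OF S2]) (rule that)
  have "norm (R (int j)) \<le> c / a ^ j \<and> norm (R (- int j)) \<le> d * b ^ j" if "j \<ge> 1" for j :: nat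
  proof
    show "norm (R (int j)) \<le> c / a ^ j"
      using c[of j] ab by (simp add: norm_scaleC norm_power field_simps)
    \<comment> \<open>The negative half lists the indices as \<open>- int (Suc n)\<close>, so index
      \<open>- j\<close> is its term number \<open>j - 1\<close>.\<close>
    obtain n where n: "j = Suc n" using \<open>j \<ge> 1\<close> by (cases j) auto
    have "b powi - int j * norm (R (- int j)) \<le> d"
      using d[of n] ab by (simp only: norm_powi_scaleC n) simp
    then show "norm (R (- int j)) \<le> d * b ^ j"
      using ab by (simp add: power_int_minus field_simps)
  qed
  then show ?thesis by blast
qed

theorem theorem1:
  fixes A\<^sub>0 A\<^sub>1 :: "'h::complex_banach \<Rightarrow>\<^sub>C\<^sub>L 'k::complex_banach"
    and A :: "complex \<Rightarrow> 'h \<Rightarrow>\<^sub>C\<^sub>L 'k"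
    and s r :: real
    and R :: "int \<Rightarrow> 'k \<Rightarrow>\<^sub>C\<^sub>L 'h"
  assumes "singular A\<^sub>0"
    and "\<And>z. A z = A\<^sub>0 + z *\<^sub>C A\<^sub>1"
    and "0 \<le> s" and "s < r"
  shows "(\<exists>Rf :: complex \<Rightarrow> 'k \<Rightarrow>\<^sub>C\<^sub>L 'h.
            (\<forall>z\<in>annulus s r. bi_sums (\<lambda>j. (z powi j) *\<^sub>C R j) (Rf z)) \<and>
            vector_analytic_on Rf (annulus s r) \<and>
            resolvent_on (annulus s r) A Rf)
     \<longleftrightarrow>
         (\<forall>\<delta>>0. \<forall>\<epsilon>>0. s < s + \<epsilon> \<and> s + \<epsilon> < r - \<delta> \<and> r - \<delta> < r \<longrightarrow>
            (\<exists>c d :: real. \<forall>j::nat. j \<ge> 1 \<longrightarrow>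
               norm (R (int j)) \<le> c / (r - \<delta>) ^ j \<and>
               norm (R (- int j)) \<le> d * (s + \<epsilon>) ^ j)) \<and>
         (\<forall>j::int.
            R (j - 1) o\<^sub>C\<^sub>L A\<^sub>1 + R j o\<^sub>C\<^sub>L A\<^sub>0 = (if j = 0 then id_cblinfun else 0) \<and>
            A\<^sub>1 o\<^sub>C\<^sub>L R (j - 1) + A\<^sub>0 o\<^sub>C\<^sub>L R j = (if j = 0 then id_cblinfun else 0))"
proof -
  have A_eq: "A = (\<lambda>z. A\<^sub>0 + z *\<^sub>C A\<^sub>1)"
    using assms(2) by blast
  define bounds where "bounds \<longleftrightarrow>
    (\<forall>\<delta>>0. \<forall>\<epsilon>>0. s < s + \<epsilon> \<and> s + \<epsilon> < r - \<delta> \<and> r - \<delta> < r \<longrightarrow>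
      (\<exists>c d :: real. \<forall>j::nat. j \<ge> 1 \<longrightarrow>
         norm (R (int j)) \<le> c / (r - \<delta>) ^ j \<and> norm (R (- int j)) \<le> d * (s + \<epsilon>) ^ j))"
  have abs: "(\<lambda>j. (z powi j) *\<^sub>C R j) abs_summable_on UNIV" if bounds "z \<in> annulus s r" for z
  proof -
    \<comment> \<open>Half the distances from \<open>cmod z\<close> to the two boundary circles,
      which puts \<open>cmod z\<close> strictly between \<open>s + \<epsilon>\<close> and
      \<open>r - \<delta>\<close>. The inner radius \<open>s + \<epsilon>\<close> is positive even
      if \<open>s = 0\<close>.\<close>
    define \<epsilon> \<delta> where "\<epsilon> = (cmod z - s) / 2" and "\<delta> = (r - cmod z) / 2"
    have *: "\<epsilon> > 0" "\<delta> > 0" "s + \<epsilon> < cmod z" "cmod z < r - \<delta>"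
      using that(2) by (auto simp: annulus_def \<epsilon>_def \<delta>_def field_simps)
    then have "s < s + \<epsilon> \<and> s + \<epsilon> < r - \<delta> \<and> r - \<delta> < r" by linarith
    from that(1)[unfolded bounds_def, rule_format, OF *(2,1) this] obtain c d where "\<forall>j::nat. j \<ge> 1 \<longrightarrow>
        norm (R (int j)) \<le> c / (r - \<delta>) ^ j \<and> norm (R (- int j)) \<le> d * (s + \<epsilon>) ^ j"
      by auto
    then show ?thesis
      using * \<open>0 \<le> s\<close> by (intro geometric_bounds_imp_abs_summable[of "s + \<epsilon>" z "r - \<delta>"]) auto
  qed
  have nz: "z \<noteq> 0" if "z \<in> annulus s r" for z
    using that \<open>0 \<le> s\<close> by (auto simp: annulus_def)
  \<comment> \<open>\<open>left\<close> serves the products \<open>R(z) A(z)\<close> and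
    \<open>right\<close> the products \<open>A(z) R(z)\<close>. The open premises are membership in
    the annulus (from \<open>nz\<close>), \<open>bounds\<close>, and membership again (from
    \<open>abs\<close>).\<close>
  note left = laurent_linear_factor[of "\<lambda>B. B o\<^sub>C\<^sub>L A\<^sub>0" "\<lambda>B. B o\<^sub>C\<^sub>L A\<^sub>1" _ R,
      OF cblinfun_compose.bounded_linear_left cblinfun_compose_scaleC_left
        cblinfun_compose.bounded_linear_left cblinfun_compose_scaleC_left nz abs]
  note right = laurent_linear_factor[of "\<lambda>B. A\<^sub>0 o\<^sub>C\<^sub>L B" "\<lambda>B. A\<^sub>1 o\<^sub>C\<^sub>L B" _ R,
      OF cblinfun_compose.bounded_linear_right cblinfun_compose_scaleC_right
        cblinfun_compose.bounded_linear_right cblinfun_compose_scaleC_right nz abs]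
  have pencil_left: "P o\<^sub>C\<^sub>L A z = P o\<^sub>C\<^sub>L A\<^sub>0 + z *\<^sub>C (P o\<^sub>C\<^sub>L A\<^sub>1)" for P :: "'k \<Rightarrow>\<^sub>C\<^sub>L 'h" and z
    by (simp add: A_eq cblinfun_compose.add_right cblinfun_compose_scaleC_right)
  have pencil_right: "A z o\<^sub>C\<^sub>L P = A\<^sub>0 o\<^sub>C\<^sub>L P + z *\<^sub>C (A\<^sub>1 o\<^sub>C\<^sub>L P)" for P :: "'k \<Rightarrow>\<^sub>C\<^sub>L 'h" and z
    by (simp add: A_eq cblinfun_compose.add_left cblinfun_compose_scaleC_left)
  show ?thesis
    unfolding bounds_def[symmetric]
  proof (intro iffI conjI allI; (elim exE conjE)?)
    fix Rf
    assume conv: "\<forall>z\<in>annulus s r. bi_sums (\<lambda>j. (z powi j) *\<^sub>C R j) (Rf z)"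
      and res: "resolvent_on (annulus s r) A Rf"
    show b: bounds
      unfolding bounds_def
    proof (intro allI impI)
      fix \<delta> \<epsilon> :: real
      assume "\<delta> > 0" "\<epsilon> > 0" "s < s + \<epsilon> \<and> s + \<epsilon> < r - \<delta> \<and> r - \<delta> < r"
      then show "\<exists>c d. \<forall>j::nat. j \<ge> 1 \<longrightarrow>
          norm (R (int j)) \<le> c / (r - \<delta>) ^ j \<and> norm (R (- int j)) \<le> d * (s + \<epsilon>) ^ j"
        using conv \<open>0 \<le> s\<close> by (intro annulus_laurent_bounds[of s r]) auto
    qed
    \<comment> \<open>A single circle inside the annulus determines all coefficients; the middle
      radius is positive because \<open>r > s \<ge> 0\<close>.\<close>
    define \<rho> where "\<rho> = (s + r) / 2"
    have \<rho>: "\<rho> > 0" "\<And>z. cmod z = \<rho> \<Longrightarrow> z \<in> annulus s r"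
      using \<open>0 \<le> s\<close> \<open>s < r\<close> by (auto simp: \<rho>_def annulus_def)
    \<comment> \<open>The bounds just derived give absolute summability, which upgrades the assumed
      two-sided convergence to an unordered sum.\<close>
    have sums: "((\<lambda>j. (z powi j) *\<^sub>C R j) has_sum Rf z) UNIV" if "z \<in> annulus s r" for z
      using bi_sums_imp_has_sum[OF abs[OF b that]] conv that by blast
    have \<rho>_mem: "complex_of_real \<rho> \<in> annulus s r" using \<rho> by simp
    fix j :: int
    show "R (j - 1) o\<^sub>C\<^sub>L A\<^sub>1 + R j o\<^sub>C\<^sub>L A\<^sub>0 = (if j = 0 then id_cblinfun else 0)"
    proof (rule laurent_constant_imp_coeff[OF \<rho>(1) left(1)[OF \<rho>_mem b \<rho>_mem]])
      fix z assume z: "cmod z = \<rho>"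
      show "((\<lambda>j. (z powi j) *\<^sub>C (R (j - 1) o\<^sub>C\<^sub>L A\<^sub>1 + R j o\<^sub>C\<^sub>L A\<^sub>0)) has_sum id_cblinfun) UNIV"
        using left(2)[OF \<rho>(2)[OF z] b \<rho>(2)[OF z] sums[OF \<rho>(2)[OF z]]] res \<rho>(2)[OF z]
        by (simp add: resolvent_on_def pencil_left)
    qed
    show "A\<^sub>1 o\<^sub>C\<^sub>L R (j - 1) + A\<^sub>0 o\<^sub>C\<^sub>L R j = (if j = 0 then id_cblinfun else 0)"
    proof (rule laurent_constant_imp_coeff[OF \<rho>(1) right(1)[OF \<rho>_mem b \<rho>_mem]])
      fix z assume z: "cmod z = \<rho>"
      show "((\<lambda>j. (z powi j) *\<^sub>C (A\<^sub>1 o\<^sub>C\<^sub>L R (j - 1) + A\<^sub>0 o\<^sub>C\<^sub>L R j)) has_sum id_cblinfun) UNIV"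
        using right(2)[OF \<rho>(2)[OF z] b \<rho>(2)[OF z] sums[OF \<rho>(2)[OF z]]] res \<rho>(2)[OF z]
        by (simp add: resolvent_on_def pencil_right)
    qed
  next
    assume b: bounds
      and fe: "\<forall>j. R (j - 1) o\<^sub>C\<^sub>L A\<^sub>1 + R j o\<^sub>C\<^sub>L A\<^sub>0 = (if j = 0 then id_cblinfun else 0) \<and>
        A\<^sub>1 o\<^sub>C\<^sub>L R (j - 1) + A\<^sub>0 o\<^sub>C\<^sub>L R j = (if j = 0 then id_cblinfun else 0)"
    define Rf where "Rf z = infsum (\<lambda>j. (z powi j) *\<^sub>C R j) UNIV" for z
    have sums: "((\<lambda>j. (z powi j) *\<^sub>C R j) has_sum Rf z) UNIV" if "z \<in> annulus s r" for z
      unfolding Rf_def by (rule has_sum_infsum[OF abs_summable_summable[OF abs[OF b that]]])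
    have "resolvent_on (annulus s r) A Rf"
      unfolding resolvent_on_def
    proof (intro ballI conjI)
      fix z assume z: "z \<in> annulus s r"
      show "Rf z o\<^sub>C\<^sub>L A z = id_cblinfun"
        unfolding pencil_left
        \<comment> \<open>By \<open>fe\<close> the coefficients of the product series are those of
          the constant identity, so both sides are sums of the same series.\<close>
        by (rule has_sum_unique[OF left(2)[OF z b z sums[OF z], unfolded fe[rule_format, THEN conjunct1]]
              has_sum_constant_laurent])
      show "A z o\<^sub>C\<^sub>L Rf z = id_cblinfun"
        unfolding pencil_right
        by (rule has_sum_unique[OF right(2)[OF z b z sums[OF z], unfolded fe[rule_format, THEN conjunct2]]
              has_sum_constant_laurent])
    qed
    moreover from this have "vector_analytic_on Rf (annulus s r)"
      unfolding A_eq by (rule resolvent_vector_analytic[OF open_annulus])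
    moreover have "bi_sums (\<lambda>j. (z powi j) *\<^sub>C R j) (Rf z)" if "z \<in> annulus s r" for z
      by (rule has_sum_imp_bi_sums[OF abs[OF b that] sums[OF that]])
    ultimately show "\<exists>Rf. (\<forall>z\<in>annulus s r. bi_sums (\<lambda>j. (z powi j) *\<^sub>C R j) (Rf z)) \<and>
        vector_analytic_on Rf (annulus s r) \<and> resolvent_on (annulus s r) A Rf"
      by blast
  qed
qed

end
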